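(* Let $G$ be a finite undirected graph (multiple edges and loops allowed) other than $K_1$, and let $\mathcal I$ be the set of ideals of $\mathrm{Fisg}(G)$. Then the lattice $\mathcal I$ ordered by inclusion is not atomic.
   Context: Graphs are finite and undirected and may have multiple edges and loops; the empty graph $\emptyset$ counts as a graph (and as a subgraph of every graph) and the empty map $\mu_0:\emptyset\to\emptyset$ counts as a graph isomorphism. $K_1$ is the graph with a single vertex and no edges. For a graph $G$, $\mathrm{Fisg}(G)$ is the set of all graph isomorphisms $\varphi:H\to J$ (bijections on vertices and on edges preserving incidence) where $H$ and $J$ are subgraphs of $G$. For $\varphi,\psi\in\mathrm{Fisg}(G)$ the product $\psi\circ\varphi$ is the composition of partial maps, with domain $\varphi^{-1}(\mathrm{Im}(\varphi)\cap\mathrm{Dom}(\psi))$ and image $\psi(\mathrm{Im}(\varphi)\cap\mathrm{Dom}(\psi))$. An ideal of a semigroup $S$ is a subset $I\subseteq S$ with $SI\subseteq I$ and $IS\subseteq I$. A finite lattice is atomic if every element is a join of atoms (elements covering the least element; the least element is the empty join).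
   Formalization: The graph G is also assumed to be nonempty, since for the empty graph Fisg(G) contains only the empty map and its lattice of ideals is atomic. *)

theory Defs
  imports "HOL-Algebra.Complete_Lattice" "HOL-Algebra.Group"
begin

record ('v, 'e) multigraph =
  verts :: "'v set"
  edges :: "'e set"
  ends :: "'e \<Rightarrow> 'v set"

text \<open>An edge with a single end is a loop; distinct edges may have the same ends. The vertex set
  may be empty.\<close>

definition finite_multigraph :: "('v, 'e) multigraph \<Rightarrow> bool" where
  "finite_multigraph G \<longleftrightarrow> finite (verts G) \<and> finite (edges G) \<and>
     (\<forall>e\<in>edges G. ends G e \<subseteq> verts G \<and> card (ends G e) \<in> {1, 2})"

definition is_K1 :: "('v, 'e) multigraph \<Rightarrow> bool" where
  "is_K1 G \<longleftrightarrow> (\<exists>v. verts G = {v}) \<and> edges G = {}"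

definition subgraph :: "('v, 'e) multigraph \<Rightarrow> ('v, 'e) multigraph \<Rightarrow> bool" where
  "subgraph H G \<longleftrightarrow> verts H \<subseteq> verts G \<and> edges H \<subseteq> edges G \<and>
     (\<forall>e\<in>edges H. ends H e = ends G e \<and> ends H e \<subseteq> verts H)"

text \<open>A partial map of graphs is a pair of a partial map of vertices and a partial map of edges.\<close>

type_synonym ('v, 'e) gmap = "('v \<rightharpoonup> 'v) \<times> ('e \<rightharpoonup> 'e)"

definition graph_iso ::
  "('v, 'e) multigraph \<Rightarrow> ('v, 'e) multigraph \<Rightarrow> ('v, 'e) gmap \<Rightarrow> bool" where
  "graph_iso H J \<phi> \<longleftrightarrow>
     dom (fst \<phi>) = verts H \<and> dom (snd \<phi>) = edges H \<and>
     bij_betw (the \<circ> fst \<phi>) (verts H) (verts J) \<and>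
     bij_betw (the \<circ> snd \<phi>) (edges H) (edges J) \<and>
     (\<forall>e\<in>edges H. ends J (the (snd \<phi> e)) = (the \<circ> fst \<phi>) ` ends H e)"

definition gmap_comp :: "('v, 'e) gmap \<Rightarrow> ('v, 'e) gmap \<Rightarrow> ('v, 'e) gmap" where
  "gmap_comp \<psi> \<phi> = (fst \<psi> \<circ>\<^sub>m fst \<phi>, snd \<psi> \<circ>\<^sub>m snd \<phi>)"

text \<open>The semigroup has an identity, the identity map of \<open>G\<close>, so it is given as a monoid
  (see \<open>Fisg_monoid\<close> below).\<close>

definition Fisg :: "('v, 'e) multigraph \<Rightarrow> ('v, 'e) gmap monoid" where
  "Fisg G =
     \<lparr>carrier = {\<phi>. \<exists>H J. subgraph H G \<and> subgraph J G \<and> graph_iso H J \<phi>},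
      mult = gmap_comp,
      one = (Some |` verts G, Some |` edges G)\<rparr>"

definition semigroup_ideal :: "'a set \<Rightarrow> ('a, 'b) monoid_scheme \<Rightarrow> bool" where
  "semigroup_ideal I S \<longleftrightarrow> I \<subseteq> carrier S \<and>
     (\<forall>s\<in>carrier S. \<forall>x\<in>I. s \<otimes>\<^bsub>S\<^esub> x \<in> I \<and> x \<otimes>\<^bsub>S\<^esub> s \<in> I)"

definition inclusion_order :: "'a set set \<Rightarrow> 'a set gorder" where
  "inclusion_order \<I> = \<lparr>carrier = \<I>, eq = (=), le = (\<subseteq>)\<rparr>"

definition covers :: "('a, 'b) gorder_scheme \<Rightarrow> 'a \<Rightarrow> 'a \<Rightarrow> bool" where
  "covers L y x \<longleftrightarrow> x \<in> carrier L \<and> y \<in> carrier L \<and> x \<sqsubset>\<^bsub>L\<^esub> y \<and>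
     \<not> (\<exists>z\<in>carrier L. x \<sqsubset>\<^bsub>L\<^esub> z \<and> z \<sqsubset>\<^bsub>L\<^esub> y)"

definition atoms :: "('a, 'b) gorder_scheme \<Rightarrow> 'a set" where
  "atoms L = {a. \<exists>b. least L b (carrier L) \<and> covers L a b}"

text \<open>\<open>least L x (Upper L A)\<close> says that \<open>x\<close> is the join of \<open>A\<close>; for \<open>A = {}\<close> it says that \<open>x\<close> is the
  least element.\<close>

definition atomic_lattice :: "('a, 'b) gorder_scheme \<Rightarrow> bool" where
  "atomic_lattice L \<longleftrightarrow> (\<forall>x\<in>carrier L. \<exists>A\<subseteq>atoms L. least L x (Upper L A))"

lemma the_image_dom: "(the \<circ> f) ` dom f = ran f"
  by (force simp: ran_def dom_def image_iff)

lemma Fisg_iff: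
  "(f, g) \<in> carrier (Fisg G) \<longleftrightarrow>
     dom f \<subseteq> verts G \<and> ran f \<subseteq> verts G \<and> dom g \<subseteq> edges G \<and> ran g \<subseteq> edges G \<and>
     inj_on f (dom f) \<and> inj_on g (dom g) \<and>
     (\<forall>e e'. g e = Some e' \<longrightarrow> ends G e \<subseteq> dom f \<and> ends G e' = (the \<circ> f) ` ends G e)"
  (is "?L \<longleftrightarrow> ?R")
proof
  assume ?L
  then obtain H J where H: "subgraph H G" and J: "subgraph J G" and iso: "graph_iso H J (f, g)"
    by (auto simp: Fisg_def)
  have d: "dom f = verts H" "dom g = edges H" and b: "bij_betw (the \<circ> f) (verts H) (verts J)"
    "bij_betw (the \<circ> g) (edges H) (edges J)"
    and e: "\<And>e. e \<in> edges H \<Longrightarrow> ends J (the (g e)) = (the \<circ> f) ` ends H e"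
    using iso by (auto simp: graph_iso_def)
  have r: "ran f = verts J" "ran g = edges J"
    using b d by (metis bij_betw_imp_surj_on the_image_dom)+
  have i: "inj_on f (dom f)" "inj_on g (dom g)"
    using b d by (auto simp: bij_betw_def inj_on_def)
  have "ends G x \<subseteq> dom f \<and> ends G x' = (the \<circ> f) ` ends G x" if "g x = Some x'" for x x'
  proof -
    have xH: "x \<in> edges H" and xJ: "x' \<in> edges J" using that d r by (auto simp: ran_def)
    have 1: "ends H x = ends G x" "ends G x \<subseteq> verts H" "ends J x' = ends G x'"
      using H J xH xJ by (auto simp: subgraph_def subset_iff)
    then show ?thesis using e[OF xH] that d by simp
  qed
  with d r i H J show ?R unfolding subgraph_def by simp
next
  assume R: ?R
  then have basic: "dom f \<subseteq> verts G" "ran f \<subseteq> verts G" "dom g \<subseteq> edges G" "ran g \<subseteq> edges G"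
    "inj_on f (dom f)" "inj_on g (dom g)"
    by - (elim conjE, assumption)+
  from R have "\<forall>e e'. g e = Some e' \<longrightarrow> ends G e \<subseteq> dom f \<and> ends G e' = (the \<circ> f) ` ends G e"
    by (elim conjE)
  then have inc: "ends G e \<subseteq> dom f" "ends G e' = (the \<circ> f) ` ends G e" if "g e = Some e'" for e e'
    using that by meson+
  define H where "H = \<lparr>verts = dom f, edges = dom g, ends = ends G\<rparr>"
  define J where "J = \<lparr>verts = ran f, edges = ran g, ends = ends G\<rparr>"
  have "ends G e \<subseteq> dom f" if "e \<in> dom g" for e using inc(1) that by blast
  then have "subgraph H G" using basic by (simp add: subgraph_def H_def)
  moreover have "subgraph J G"
  proof -
    have "ends G e' \<subseteq> ran f" if "e' \<in> ran g" for e'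
    proof -
      obtain e where e: "g e = Some e'" using \<open>e' \<in> ran g\<close> by (auto simp: ran_def)
      show ?thesis unfolding inc(2)[OF e] the_image_dom[of f, symmetric]
        by (rule image_mono[OF inc(1)[OF e]])
    qed
    then show ?thesis using basic by (simp add: subgraph_def J_def)
  qed
  moreover have "graph_iso H J (f, g)"
  proof -
    have "inj_on (the \<circ> f) (dom f)" "inj_on (the \<circ> g) (dom g)"
      using basic(5,6) unfolding inj_on_def comp_def by (metis domIff option.expand)+
    moreover have "ends G (the (g e)) = (the \<circ> f) ` ends G e" if "e \<in> dom g" for e
    proof -
      obtain e' where e': "g e = Some e'" using \<open>e \<in> dom g\<close> by blast
      show ?thesis unfolding inc(2)[OF e', symmetric] by (simp add: e')
    qed
    ultimately show ?thesis using basic by (simp add: graph_iso_def H_def J_def bij_betw_def the_image_dom del: o_apply)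
  qed
  ultimately show ?L unfolding Fisg_def by force
qed

lemma Fisg_comp_closed:
  assumes "\<phi> \<in> carrier (Fisg G)" "\<psi> \<in> carrier (Fisg G)"
  shows "gmap_comp \<psi> \<phi> \<in> carrier (Fisg G)"
proof -
  obtain f g where p: "\<phi> = (f, g)" by (cases \<phi>)
  obtain f' g' where q: "\<psi> = (f', g')" by (cases \<psi>)
  have A: "dom f \<subseteq> verts G \<and> ran f \<subseteq> verts G \<and> dom g \<subseteq> edges G \<and> ran g \<subseteq> edges G \<and>
     inj_on f (dom f) \<and> inj_on g (dom g)"
    and A2: "\<And>e e'. g e = Some e' \<Longrightarrow> ends G e \<subseteq> dom f \<and> ends G e' = (the \<circ> f) ` ends G e"
    using assms(1) unfolding p Fisg_iff by auto
  have B: "dom f' \<subseteq> verts G \<and> ran f' \<subseteq> verts G \<and> dom g' \<subseteq> edges G \<and> ran g' \<subseteq> edges G \<and>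
     inj_on f' (dom f') \<and> inj_on g' (dom g')"
    and B2: "\<And>e e'. g' e = Some e' \<Longrightarrow> ends G e \<subseteq> dom f' \<and> ends G e' = (the \<circ> f') ` ends G e"
    using assms(2) unfolding q Fisg_iff by auto
  have inj: "inj_on (h' \<circ>\<^sub>m h) (dom (h' \<circ>\<^sub>m h))" if "inj_on h (dom h)" "inj_on h' (dom h')"
    for h h' :: "'x \<rightharpoonup> 'x"
    using that by (auto simp: inj_on_def map_comp_def dom_def split: option.splits)
  have E: "ends G e \<subseteq> dom (f' \<circ>\<^sub>m f) \<and> ends G e' = (the \<circ> (f' \<circ>\<^sub>m f)) ` ends G e"
    if h: "(g' \<circ>\<^sub>m g) e = Some e'" for e e'
  proof -
    obtain d where d: "g e = Some d" "g' d = Some e'"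
      using h by (auto simp: map_comp_Some_iff)
    note a = A2[OF d(1)] and b = B2[OF d(2)]
    have D: "ends G e \<subseteq> dom (f' \<circ>\<^sub>m f)"
    proof
      fix v assume v: "v \<in> ends G e"
      then obtain w where w: "f v = Some w" using a by blast
      then have "w \<in> ends G d" using a v by force
      then obtain u where "f' w = Some u" using b by blast
      then show "v \<in> dom (f' \<circ>\<^sub>m f)" using w by (auto simp: map_comp_Some_iff)
    qed
    have "ends G e' = (\<lambda>v. the (f' (the (f v)))) ` ends G e"
      using a b by (simp add: image_image)
    also have "\<dots> = (the \<circ> (f' \<circ>\<^sub>m f)) ` ends G e"
    proof (rule image_cong[OF refl])
      fix v assume "v \<in> ends G e"
      then obtain w where "f v = Some w" using a by blast
      then show "the (f' (the (f v))) = (the \<circ> (f' \<circ>\<^sub>m f)) v" by simp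
    qed
    finally show ?thesis using D by simp
  qed
  have "dom (f' \<circ>\<^sub>m f) \<subseteq> dom f" "dom (g' \<circ>\<^sub>m g) \<subseteq> dom g" "ran (f' \<circ>\<^sub>m f) \<subseteq> ran f'" "ran (g' \<circ>\<^sub>m g) \<subseteq> ran g'"
    by (auto simp: map_comp_Some_iff ran_def)
  then show ?thesis unfolding p q gmap_comp_def fst_conv snd_conv Fisg_iff
    using A B inj E by (meson subset_trans)
qed

lemma Fisg_restrict:
  assumes "subgraph H G" shows "(Some |` verts H, Some |` edges H) \<in> carrier (Fisg G)"
proof -
  have [simp]: "dom (Some |` A) = A" "ran (Some |` A) = A" "inj_on (Some |` A) A" for A :: "'x set"
    by (auto simp: restrict_map_def dom_def ran_def inj_on_def split: if_splits)
  have "ends G e \<subseteq> verts H \<and> ends G e' = (the \<circ> (Some |` verts H)) ` ends G e"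
    if "(Some |` edges H) e = Some e'" for e e'
  proof -
    have "e \<in> edges H" "e' = e" using that by (auto simp: restrict_map_def split: if_splits)
    then have sub: "ends G e \<subseteq> verts H" using assms by (metis subgraph_def)
    then have "(the \<circ> (Some |` verts H)) ` ends G e = id ` ends G e"
      by (intro image_cong) auto
    then show ?thesis using sub \<open>e' = e\<close> by simp
  qed
  then show ?thesis unfolding Fisg_iff using assms by (simp add: subgraph_def)
qed

lemma Fisg_monoid:
  assumes "finite_multigraph G"
  shows "Group.monoid (Fisg G)"
proof (rule monoidI)
  fix x y assume "x \<in> carrier (Fisg G)" "y \<in> carrier (Fisg G)"
  then show "x \<otimes>\<^bsub>Fisg G\<^esub> y \<in> carrier (Fisg G)"
    using Fisg_comp_closed[of y G x] by (simp add: Fisg_def)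
next
  have "subgraph G G" using assms by (auto simp: subgraph_def finite_multigraph_def)
  from Fisg_restrict[OF this] show "\<one>\<^bsub>Fisg G\<^esub> \<in> carrier (Fisg G)" by (simp add: Fisg_def)
next
  fix x y z
  show "x \<otimes>\<^bsub>Fisg G\<^esub> y \<otimes>\<^bsub>Fisg G\<^esub> z = x \<otimes>\<^bsub>Fisg G\<^esub> (y \<otimes>\<^bsub>Fisg G\<^esub> z)"
    by (auto simp: Fisg_def gmap_comp_def fun_eq_iff map_comp_def split: option.splits)
next
  fix x assume x: "x \<in> carrier (Fisg G)"
  obtain f g where p: "x = (f, g)" by (cases x)
  have A: "dom f \<subseteq> verts G" "ran f \<subseteq> verts G" "dom g \<subseteq> edges G" "ran g \<subseteq> edges G"
    using x unfolding p Fisg_iff by auto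
  have l: "(Some |` S) \<circ>\<^sub>m h = h" if "ran h \<subseteq> S" for h :: "'x \<rightharpoonup> 'x" and S
    using that by (auto simp: fun_eq_iff map_comp_def restrict_map_def ran_def split: option.splits)
  have r: "h \<circ>\<^sub>m (Some |` S) = h" if "dom h \<subseteq> S" for h :: "'x \<rightharpoonup> 'x" and S
  proof
    fix x show "(h \<circ>\<^sub>m (Some |` S)) x = h x"
    proof (cases "x \<in> S")
      case False then have "h x = None" using that by blast
      then show ?thesis using False by (simp add: map_comp_def restrict_map_def)
    qed (simp add: map_comp_def restrict_map_def)
  qed
  show "\<one>\<^bsub>Fisg G\<^esub> \<otimes>\<^bsub>Fisg G\<^esub> x = x" "x \<otimes>\<^bsub>Fisg G\<^esub> \<one>\<^bsub>Fisg G\<^esub> = x"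
    using A by (auto simp: Fisg_def gmap_comp_def p l r)
qed

text \<open>Some authors do not admit the empty set as an
  ideal; with and without it, the ideals form a lattice.\<close>

lemma ideals_lattice:
  "lattice (inclusion_order {I. semigroup_ideal I S})"
  "Group.monoid S \<Longrightarrow> lattice (inclusion_order {I. semigroup_ideal I S \<and> I \<noteq> {}})"
proof -
  have *: "lattice (inclusion_order C)" if "\<And>I J. I \<in> C \<Longrightarrow> J \<in> C \<Longrightarrow> I \<union> J \<in> C \<and> I \<inter> J \<in> C" for C :: "'x set set"
  proof -
    interpret partial_order "inclusion_order C"
      by unfold_locales (auto simp: inclusion_order_def)
    show ?thesis
    proof (unfold_locales, goal_cases)
      case (1 x y)
      then show ?case using that[of x y]
        by (intro exI[of _ "x \<union> y"]) (auto simp: least_def Upper_def inclusion_order_def)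
    next
      case (2 x y)
      then show ?case using that[of x y]
        by (intro exI[of _ "x \<inter> y"]) (auto simp: greatest_def Lower_def inclusion_order_def)
    qed
  qed
  show "lattice (inclusion_order {I. semigroup_ideal I S})"
    by (rule *) (auto simp: semigroup_ideal_def)
  assume "Group.monoid S"
  have "I \<inter> J \<noteq> {}" if I: "semigroup_ideal I S" "I \<noteq> {}" and J: "semigroup_ideal J S" "J \<noteq> {}" for I J
  proof -
    obtain x y where "x \<in> I" "y \<in> J" using I J by auto
    then have "x \<otimes>\<^bsub>S\<^esub> y \<in> I \<inter> J" using I J unfolding semigroup_ideal_def by blast
    then show ?thesis by blast
  qed
  then show "lattice (inclusion_order {I. semigroup_ideal I S \<and> I \<noteq> {}})"
    by (intro *) (auto simp: semigroup_ideal_def)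
qed

end

(*
  Every semigroup ideal with an element other than the empty map contains all isomorphisms between
  one-vertex subgraphs: factor v \<mapsto> w through a vertex in the domain of that element. Together with
  the empty map, these isomorphisms form an ideal M comparable to every ideal and strictly above the
  zero ideal, so all atoms lie below M and so do their joins. But if G has at least two vertices, or
  an edge, the identity of G lies outside M.
*)
theory Submission
  imports Defs
begin

text \<open>Since \<open>Z \<subset> M\<close>, the least element of \<open>C\<close> lies strictly
  below \<open>M\<close>. An atom strictly above \<open>M\<close> would have \<open>M\<close>
  strictly between it and the least element, so comparability puts every atom inside
  \<open>M\<close>. Thus \<open>M\<close> bounds every set of atoms, and \<open>T\<close> is not a
  join of atoms.\<close>

lemma not_atomic_inclusion_order:
  assumes "M \<in> C" "Z \<in> C" "Z \<subset> M" "T \<in> C" "\<not> T \<subseteq> M"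
    and comp: "\<And>I. I \<in> C \<Longrightarrow> I \<subseteq> M \<or> M \<subseteq> I"
  shows "\<not> atomic_lattice (inclusion_order C)"
proof
  assume "atomic_lattice (inclusion_order C)"
  then obtain A where A: "A \<subseteq> atoms (inclusion_order C)"
    and T: "least (inclusion_order C) T (Upper (inclusion_order C) A)"
    using \<open>T \<in> C\<close> by (auto simp: atomic_lattice_def inclusion_order_def)
  have "a \<in> C \<and> a \<subseteq> M" if "a \<in> atoms (inclusion_order C)" for a
  proof -
    obtain b where b: "least (inclusion_order C) b C" "covers (inclusion_order C) a b"
    proof -
      have "carrier (inclusion_order C) = C"
        by (simp add: inclusion_order_def)
      then show thesis
        using that \<open>a \<in> atoms (inclusion_order C)\<close> by (auto simp: atoms_def)
    qed
    have "b \<subset> M"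
      using b(1) assms(2,3) by (auto simp: least_def inclusion_order_def)
    moreover have "a \<in> C" "\<not> (b \<subset> M \<and> M \<subset> a)"
      using b(2) \<open>M \<in> C\<close> by (auto simp: covers_def inclusion_order_def lless_def)
    ultimately show ?thesis
      using comp[of a] by blast
  qed
  then have "M \<in> Upper (inclusion_order C) A"
    using A \<open>M \<in> C\<close> by (auto simp: Upper_def inclusion_order_def)
  with T \<open>\<not> T \<subseteq> M\<close> show False
    by (auto simp: least_def inclusion_order_def)
qed

text \<open>The inclusion \<open>dom f \<subseteq> {v}\<close>, rather than equality, admits the
  empty map; \<open>g = Map.empty\<close> excludes loops at the vertex.\<close>

definition one_vertex_isos :: "('v, 'e) multigraph \<Rightarrow> ('v, 'e) gmap set" where
  "one_vertex_isos G = {(f, g) \<in> carrier (Fisg G). g = Map.empty \<and> (\<exists>v. dom f \<subseteq> {v})}"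

lemma mult_Fisg: "\<psi> \<otimes>\<^bsub>Fisg G\<^esub> \<phi> = gmap_comp \<psi> \<phi>"
  by (simp add: Fisg_def)

lemma empty_in_Fisg: "(Map.empty, Map.empty) \<in> carrier (Fisg G)"
  by (simp add: Fisg_iff)

lemma singleton_in_Fisg:
  "v \<in> verts G \<Longrightarrow> w \<in> verts G \<Longrightarrow> ([v \<mapsto> w], Map.empty) \<in> carrier (Fisg G)"
  by (simp add: Fisg_iff)

lemma semigroup_ideal_carrier_Fisg: "semigroup_ideal (carrier (Fisg G)) (Fisg G)"
  by (simp add: semigroup_ideal_def mult_Fisg Fisg_comp_closed)

lemma map_comp_empty_right: "f \<circ>\<^sub>m Map.empty = Map.empty"
  by (simp add: fun_eq_iff map_comp_def)

lemma semigroup_ideal_zero: "semigroup_ideal {(Map.empty, Map.empty)} (Fisg G)"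
  by (auto simp: semigroup_ideal_def mult_Fisg gmap_comp_def empty_in_Fisg map_comp_empty_right)

lemma semigroup_ideal_one_vertex_isos: "semigroup_ideal (one_vertex_isos G) (Fisg G)"
  unfolding semigroup_ideal_def
proof (intro conjI ballI)
  show "one_vertex_isos G \<subseteq> carrier (Fisg G)"
    by (auto simp: one_vertex_isos_def)
next
  fix s x assume s: "s \<in> carrier (Fisg G)" and x: "x \<in> one_vertex_isos G"
  obtain f g h v where sx: "s = (f, g)" "x = (h, Map.empty)" and v: "dom h \<subseteq> {v}"
    and xc: "x \<in> carrier (Fisg G)"
    using x by (cases s) (auto simp: one_vertex_isos_def)
  have "dom (f \<circ>\<^sub>m h) \<subseteq> {v}"
    using v by (fastforce simp: map_comp_Some_iff)
  then show "s \<otimes>\<^bsub>Fisg G\<^esub> x \<in> one_vertex_isos G"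
    using Fisg_comp_closed[OF xc s]
    by (auto simp: one_vertex_isos_def mult_Fisg gmap_comp_def sx map_comp_empty_right)
  have inj: "inj_on f (dom f)"
    using s by (simp add: sx Fisg_iff)
  \<comment> \<open>Composing on the right pulls the domain back along \<open>f\<close>; by
    injectivity, the preimage of \<open>{v}\<close> is still at most one vertex.\<close>
  have "a = b" if "a \<in> dom (h \<circ>\<^sub>m f)" "b \<in> dom (h \<circ>\<^sub>m f)" for a b
  proof -
    have "f a = Some v" "f b = Some v"
      using that v by (fastforce simp: map_comp_Some_iff)+
    then show ?thesis
      using inj_onD[OF inj, of a b] by auto
  qed
  then have "\<exists>u. dom (h \<circ>\<^sub>m f) \<subseteq> {u}"
    by blast
  then show "x \<otimes>\<^bsub>Fisg G\<^esub> s \<in> one_vertex_isos G"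
    using Fisg_comp_closed[OF s xc]
    by (auto simp: one_vertex_isos_def mult_Fisg gmap_comp_def sx)
qed

lemma one_vertex_isos_subset_ideal:
  assumes fin: "finite_multigraph G" and I: "semigroup_ideal I (Fisg G)"
    and p: "p \<in> I" "p \<noteq> (Map.empty, Map.empty)"
  shows "one_vertex_isos G \<subseteq> I"
proof
  fix x assume x: "x \<in> one_vertex_isos G"
  obtain f g where fg: "p = (f, g)"
    by (cases p)
  have pc: "(f, g) \<in> carrier (Fisg G)"
    using I p(1) by (auto simp: fg semigroup_ideal_def)
  \<comment> \<open>An edge in the domain of \<open>g\<close> brings its ends into the domain of
    \<open>f\<close>, and every edge, even a loop, has at least one end.\<close>
  have "f \<noteq> Map.empty"
  proof
    assume "f = Map.empty"
    with p(2) fg obtain e e' where e: "g e = Some e'"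
      by fastforce
    then have "ends G e \<subseteq> dom f" "e \<in> edges G"
      using pc by (auto simp: Fisg_iff)
    then show False
      using fin \<open>f = Map.empty\<close> by (force simp: finite_multigraph_def)
  qed
  then obtain a b where ab: "f a = Some b"
    by fastforce
  then have abG: "a \<in> verts G" "b \<in> verts G"
    using pc by (auto simp: Fisg_iff ran_def)
  obtain h v where h: "x = (h, Map.empty)" "dom h \<subseteq> {v}" "(h, Map.empty) \<in> carrier (Fisg G)"
    using x by (auto simp: one_vertex_isos_def)
  show "x \<in> I"
  proof (cases "h v")
    \<comment> \<open>Here \<open>x\<close> is the empty map, obtained by multiplying
      \<open>p\<close> by the empty map.\<close>
    case None
    then have "dom h = {}"
      using h(2) by auto
    moreover have "(Map.empty, Map.empty) \<otimes>\<^bsub>Fisg G\<^esub> p \<in> I"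
      using I p(1) empty_in_Fisg unfolding semigroup_ideal_def by blast
    ultimately show ?thesis
      by (simp add: h(1) mult_Fisg gmap_comp_def fg)
  next
    case (Some w)
    then have vw: "v \<in> verts G" "w \<in> verts G"
      using h(3) by (auto simp: Fisg_iff ran_def)
    \<comment> \<open>The product sends \<open>v\<close> to \<open>a\<close>, then by
      \<open>p\<close> to \<open>b\<close>, then to \<open>w\<close>; the outer factors erase
      whatever \<open>p\<close> does on edges and on other vertices.\<close>
    have "([b \<mapsto> w], Map.empty) \<otimes>\<^bsub>Fisg G\<^esub> (p \<otimes>\<^bsub>Fisg G\<^esub> ([v \<mapsto> a], Map.empty)) \<in> I"
      using I p(1) singleton_in_Fisg[OF abG(2) vw(2)] singleton_in_Fisg[OF vw(1) abG(1)]
      unfolding semigroup_ideal_def by blast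
    moreover have "[b \<mapsto> w] \<circ>\<^sub>m (f \<circ>\<^sub>m [v \<mapsto> a]) = h"
    proof
      fix u
      show "([b \<mapsto> w] \<circ>\<^sub>m (f \<circ>\<^sub>m [v \<mapsto> a])) u = h u"
      proof (cases "u = v")
        case False
        then have "h u = None"
          using h(2) by blast
        then show ?thesis
          using False by (simp add: map_comp_def)
      qed (simp add: map_comp_def Some ab)
    qed
    ultimately show ?thesis
      by (simp add: h(1) mult_Fisg gmap_comp_def fg map_comp_empty_right)
  qed
qed

text \<open>The witness is the identity of \<open>G\<close>: its domain is all of \<open>G\<close>,
  so its membership would leave at most one vertex and no edges.\<close>

lemma carrier_Fisg_not_subset_one_vertex_isos:
  assumes fin: "finite_multigraph G" and "verts G \<noteq> {}" "\<not> is_K1 G"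
  shows "\<not> carrier (Fisg G) \<subseteq> one_vertex_isos G"
proof
  assume *: "carrier (Fisg G) \<subseteq> one_vertex_isos G"
  have "subgraph G G"
    using fin by (auto simp: subgraph_def finite_multigraph_def)
  from Fisg_restrict[OF this] * have "(Some |` verts G, Some |` edges G) \<in> one_vertex_isos G"
    by blast
  then obtain v where "dom (Some |` verts G) \<subseteq> {v}" and E: "Some |` edges G = Map.empty"
    by (auto simp: one_vertex_isos_def)
  then have "verts G \<subseteq> {v}"
    by simp
  moreover have "edges G = {}"
    using arg_cong[OF E, of dom] by simp
  ultimately show False
    using assms(2,3) by (auto simp: is_K1_def)
qed

theorem proposition4p16:
  fixes G :: "('v, 'e) multigraph"
  assumes "finite_multigraph G"
    and "verts G \<noteq> {}"
    and "\<not> is_K1 G"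
  shows "\<not> atomic_lattice (inclusion_order {I. semigroup_ideal I (Fisg G)}) \<and>
         \<not> atomic_lattice (inclusion_order {I. semigroup_ideal I (Fisg G) \<and> I \<noteq> {}})"
proof -
  let ?Z = "{(Map.empty, Map.empty)} :: ('v, 'e) gmap set"
  have Z_sub: "?Z \<subseteq> one_vertex_isos G"
    by (simp add: one_vertex_isos_def empty_in_Fisg)
  obtain v where "v \<in> verts G"
    using assms(2) by blast
  then have "([v \<mapsto> v], Map.empty) \<in> one_vertex_isos G"
    by (auto simp: one_vertex_isos_def singleton_in_Fisg)
  moreover have "([v \<mapsto> v], Map.empty) \<notin> ?Z"
    by simp
  ultimately have Z: "?Z \<subset> one_vertex_isos G"
    using Z_sub by blast
  \<comment> \<open>An ideal with no element besides the empty map is contained in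
    \<open>?Z\<close>.\<close>
  have comp: "I \<subseteq> one_vertex_isos G \<or> one_vertex_isos G \<subseteq> I" if "semigroup_ideal I (Fisg G)" for I
    using one_vertex_isos_subset_ideal[OF assms(1) that] Z_sub by blast
  note facts = Z carrier_Fisg_not_subset_one_vertex_isos[OF assms] comp
    semigroup_ideal_one_vertex_isos[of G] semigroup_ideal_zero[of G] semigroup_ideal_carrier_Fisg[of G]
  show ?thesis
  proof
    show "\<not> atomic_lattice (inclusion_order {I. semigroup_ideal I (Fisg G)})"
      \<comment> \<open>In this family the least element is \<open>{}\<close> and not
        \<open>?Z\<close>; it suffices that \<open>?Z\<close> is a member strictly below
        \<open>one_vertex_isos G\<close>.\<close>
      by (rule not_atomic_inclusion_order[of "one_vertex_isos G" _ ?Z "carrier (Fisg G)"])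
        (use facts in auto)
    show "\<not> atomic_lattice (inclusion_order {I. semigroup_ideal I (Fisg G) \<and> I \<noteq> {}})"
      by (rule not_atomic_inclusion_order[of "one_vertex_isos G" _ ?Z "carrier (Fisg G)"])
        (use facts in auto)
  qed
qed

end
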